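(* Let $\mathcal{A}$ be a unital $C^*$-algebra and let $\mathcal{F}\subseteq\mathcal{A}$ be an ideal of finite type elements. Then the sets $\mathcal{K}\Phi_{+}^{-}(\mathcal{A})$, $\mathcal{K}\Phi_{-}^{+}(\mathcal{A})$ and $\mathcal{K}\Phi_{0}(\mathcal{A})$ are semigroups under multiplication (i.e. each of them is closed under the multiplication of $\mathcal{A}$).
   Context: Ideal of finite type elements: a subalgebra $\mathcal{F}\subseteq\mathcal{A}$ such that (i) $\mathcal{F}$ is a selfadjoint ideal: $ab,ba\in\mathcal{F}$ for all $a\in\mathcal{A}$, $b\in\mathcal{F}$, and $a\in\mathcal{F}$ implies $a^*\in\mathcal{F}$; (ii) there is an approximate unit $(p_\alpha)$ (in the norm topology) for $\mathcal{F}$ consisting of projections; (iii) if $p,q\in\mathcal{F}$ are projections, then there exists $v\in\mathcal{A}$ such that $vv^*=q$ and $v^*v\perp p$, i.e. $v^*v+p$ is a projection. For projections $p,q\in\mathcal{A}$: $p\sim q$ means there is $v\in\mathcal{A}$ with $vv^*=p$, $v^*v=q$; $p\preceq q$ means there is a projection $p'\in\mathcal{A}$ with $p'\le q$ and $p\sim p'$. For $a\in\mathcal{A}$ and projections $p,q\in\mathcal{A}$, $a$ is invertible up to the pair $(p,q)$ if, with $a'=(1-q)a(1-p)$, there is $b\in\mathcal{A}$ with $b=(1-p)b(1-q)$, $a'b=1-q$, $ba'=1-p$. With respect to the fixed ideal $\mathcal{F}$: $\mathcal{K}\Phi_{+}^{-}(\mathcal{A})$ (upper semi-Weyl type), resp.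 $\mathcal{K}\Phi_{-}^{+}(\mathcal{A})$ (lower semi-Weyl type), resp. $\mathcal{K}\Phi_{0}(\mathcal{A})$ (Weyl type), is the set of $a\in\mathcal{A}$ that are invertible up to some pair $(p,q)$ of projections in $\mathcal{A}$ with $p\in\mathcal{F}$ and $p\preceq q$, resp. $q\in\mathcal{F}$ and $q\preceq p$, resp. $p,q\in\mathcal{F}$ and $p\sim q$. *)

theory Defs
  imports "HOL-Analysis.Analysis"
begin

text \<open>Unital \<open>C\<^sup>*\<close>-algebras. The class \<open>monoid_mult\<close> is used instead of
  \<open>real_normed_algebra_1\<close> so that the zero algebra is not excluded.\<close>

class unital_cstar_algebra = real_normed_algebra + banach + monoid_mult +
  fixes scaleC :: "complex \<Rightarrow> 'a \<Rightarrow> 'a"  (infixr \<open>*\<^sub>C\<close> 75)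
    and star :: "'a \<Rightarrow> 'a"
  assumes scaleC_add_right: "c *\<^sub>C (x + y) = c *\<^sub>C x + c *\<^sub>C y"
    and scaleC_add_left: "(c + d) *\<^sub>C x = c *\<^sub>C x + d *\<^sub>C x"
    and scaleC_scaleC: "c *\<^sub>C (d *\<^sub>C x) = (c * d) *\<^sub>C x"
    and scaleC_of_real: "complex_of_real r *\<^sub>C x = r *\<^sub>R x"
    and scaleC_mult_left: "(c *\<^sub>C x) * y = c *\<^sub>C (x * y)"
    and scaleC_mult_right: "x * (c *\<^sub>C y) = c *\<^sub>C (x * y)"
    and norm_scaleC: "norm (c *\<^sub>C x) = cmod c * norm x"
    and star_star: "star (star x) = x"
    and star_add: "star (x + y) = star x + star y"
    and star_scaleC: "star (c *\<^sub>C x) = cnj c *\<^sub>C star x"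
    and star_mult: "star (x * y) = star y * star x"
    and norm_star_mult_self: "norm (star x * x) = (norm x)\<^sup>2"

instantiation complex :: unital_cstar_algebra
begin

definition scaleC_complex :: "complex \<Rightarrow> complex \<Rightarrow> complex"
  where "scaleC_complex c x = c * x"

definition star_complex :: "complex \<Rightarrow> complex"
  where "star_complex x = cnj x"

instance
  by standard
    (auto simp: scaleC_complex_def star_complex_def algebra_simps norm_mult
       scaleR_conv_of_real power2_eq_square)

end

context unital_cstar_algebra
begin

definition is_projection :: "'a \<Rightarrow> bool"
  where "is_projection p \<longleftrightarrow> p * p = p \<and> star p = p"

text \<open>The usual order on projections; see \<open>proj_le_iff\<close> below.\<close>

definition proj_le :: "'a \<Rightarrow> 'a \<Rightarrow> bool"
  where "proj_le p q \<longleftrightarrow> p * q = p"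

definition proj_equiv :: "'a \<Rightarrow> 'a \<Rightarrow> bool"
  where "proj_equiv p q \<longleftrightarrow> (\<exists>v. v * star v = p \<and> star v * v = q)"

definition proj_subequiv :: "'a \<Rightarrow> 'a \<Rightarrow> bool"
  where "proj_subequiv p q \<longleftrightarrow>
    (\<exists>p'. is_projection p' \<and> proj_le p' q \<and> proj_equiv p p')"

definition is_subalgebra :: "'a set \<Rightarrow> bool"
  where "is_subalgebra F \<longleftrightarrow>
    0 \<in> F \<and> (\<forall>a\<in>F. \<forall>b\<in>F. a + b \<in> F) \<and> (\<forall>c. \<forall>a\<in>F. c *\<^sub>C a \<in> F) \<and>
    (\<forall>a\<in>F. \<forall>b\<in>F. a * b \<in> F)"

definition is_selfadjoint_ideal :: "'a set \<Rightarrow> bool"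
  where "is_selfadjoint_ideal F \<longleftrightarrow>
    (\<forall>a. \<forall>b\<in>F. a * b \<in> F \<and> b * a \<in> F) \<and> (\<forall>a\<in>F. star a \<in> F)"

text \<open>Nets are families \<open>u\<close> along a proper filter \<open>G\<close> on the index type (for a directed index set,
  the filter generated by its tails).\<close>

definition approximate_unit :: "'a set \<Rightarrow> 'i filter \<Rightarrow> ('i \<Rightarrow> 'a) \<Rightarrow> bool"
  where "approximate_unit F G u \<longleftrightarrow>
    G \<noteq> bot \<and> (\<forall>i. u i \<in> F) \<and>
    (\<forall>b\<in>F. ((\<lambda>i. u i * b) \<longlongrightarrow> b) G \<and> ((\<lambda>i. b * u i) \<longlongrightarrow> b) G)"

text \<open>Existential quantification over all index types is not available; by
  \<open>approximate_unit_reindex\<close> below it is no restriction to index by the algebra itself.\<close>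

definition finite_type_ideal :: "'a set \<Rightarrow> bool"
  where "finite_type_ideal F \<longleftrightarrow>
    is_subalgebra F \<and> is_selfadjoint_ideal F \<and>
    (\<exists>(G :: 'a filter) u. approximate_unit F G u \<and> (\<forall>i. is_projection (u i))) \<and>
    (\<forall>p\<in>F. \<forall>q\<in>F. is_projection p \<longrightarrow> is_projection q \<longrightarrow>
      (\<exists>v. v * star v = q \<and> is_projection (star v * v + p)))"

definition invertible_up_to :: "'a \<Rightarrow> 'a \<Rightarrow> 'a \<Rightarrow> bool"
  where "invertible_up_to a p q \<longleftrightarrow>
    (let a' = (1 - q) * a * (1 - p) in
      \<exists>b. b = (1 - p) * b * (1 - q) \<and> a' * b = 1 - q \<and> b * a' = 1 - p)"

definition upper_semi_Weyl :: "'a set \<Rightarrow> 'a set"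
  where "upper_semi_Weyl F =
    {a. \<exists>p q. is_projection p \<and> is_projection q \<and> p \<in> F \<and> proj_subequiv p q \<and>
      invertible_up_to a p q}"

definition lower_semi_Weyl :: "'a set \<Rightarrow> 'a set"
  where "lower_semi_Weyl F =
    {a. \<exists>p q. is_projection p \<and> is_projection q \<and> q \<in> F \<and> proj_subequiv q p \<and>
      invertible_up_to a p q}"

definition Weyl_type :: "'a set \<Rightarrow> 'a set"
  where "Weyl_type F =
    {a. \<exists>p q. is_projection p \<and> is_projection q \<and> p \<in> F \<and> q \<in> F \<and> proj_equiv p q \<and>
      invertible_up_to a p q}"

end

lemma approximate_unit_reindex:
  fixes F :: "'a::unital_cstar_algebra set" and G :: "'i filter"
  assumes "approximate_unit F G u" "\<And>i. is_projection (u i)"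
  shows "\<exists>(G' :: 'a filter) u'. approximate_unit F G' u' \<and> (\<forall>x. is_projection (u' x))"
proof (intro exI conjI)
  let ?u = "\<lambda>x. if x \<in> range u then x else u undefined"
  have "?u (u i) = u i" for i by simp
  then show "approximate_unit F (filtermap u G) ?u"
    using assms(1) unfolding approximate_unit_def
    by (auto simp: filtermap_bot_iff filterlim_filtermap)
  show "\<forall>x. is_projection (?u x)" using assms(2) by auto
qed

lemma proj_le_iff:
  fixes p q :: "'a::unital_cstar_algebra"
  assumes "is_projection p" "is_projection q"
  shows "proj_le p q \<longleftrightarrow> is_projection (q - p)"
proof -
  have pp: "p * p = p" "q * q = q" "star p = p" "star q = q"
    using assms by (auto simp: is_projection_def)
  have star_diff: "star (q - p) = q - p"
    using star_add[of "q - p" p] pp by (simp add: algebra_simps)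
  show ?thesis
  proof
    assume "proj_le p q"
    then have pq: "p * q = p" by (simp add: proj_le_def)
    then have "q * p = p" using star_mult[of p q] pp by simp
    then show "is_projection (q - p)"
      using pp pq star_diff by (simp add: is_projection_def algebra_simps)
  next
    assume "is_projection (q - p)"
    then have "(q - p) * (q - p) = q - p" by (simp add: is_projection_def)
    then have s: "q * p + p * q = p + p"
      using pp by (simp add: algebra_simps)
    have l: "p * q * p + p * q = p + p"
      using arg_cong[OF s, of "\<lambda>x. p * x"] pp
      by (simp add: distrib_left mult.assoc[symmetric])
    have r: "q * p + p * q * p = p + p"
      using arg_cong[OF s, of "\<lambda>x. x * p"] pp
      by (simp add: distrib_right mult.assoc)
    have "p * q = q * p" using l r by (metis add.commute add_left_cancel)
    then have "2 *\<^sub>R (p * q) = 2 *\<^sub>R p" using s by (simp add: scaleR_2)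
    then show "proj_le p q" by (simp add: proj_le_def)
  qed
qed

end

theory Submission
  imports Defs
begin

text \<open>
  An element is upper semi-Weyl iff it is of the form \<open>g + f\<close> with \<open>g\<close> left invertible and
  \<open>f \<in> F\<close>, and Weyl iff \<open>g\<close> can be taken invertible; since \<open>F\<close> is an ideal, both conditions are
  stable under multiplication, and the lower case follows by taking adjoints. For the nontrivial
  direction pick a projection \<open>p \<in> F\<close> from the approximate unit with \<open>f(1 - p)\<close> small. Then
  \<open>h = g + f(1 - p)\<close> is still left invertible and \<open>(g + f)(1 - p) = h(1 - p)\<close>, so that \<open>g + f\<close> is
  invertible up to \<open>(p, q)\<close>, where \<open>1 - q\<close> is the range projection of \<open>h(1 - p)\<close>; the polar
  decomposition of \<open>h(h\<^sup>*h)\<^sup>-\<^sup>1p\<close> shows \<open>p \<preceq> q\<close>. This requires square roots and the positivity of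
  \<open>h\<^sup>*h\<close>, which are obtained without spectral theory.
\<close>

section \<open>Involution, complex scalars and norm\<close>

text \<open>Instantiated through \<open>THEN\<close>, this rewrites inside products that
  \<open>mult.assoc\<close> has nested to the right.\<close>

lemma mult_eq_reassoc:
  fixes x y z w :: "'a::unital_cstar_algebra"
  assumes "x * y = z"
  shows "x * (y * w) = z * w"
  using assms by (simp add: mult.assoc[symmetric])

lemma star_zero [simp]: "star (0::'a::unital_cstar_algebra) = 0"
  using star_add[of 0 0] by simp

lemma star_minus: "star (- x) = - star (x::'a::unital_cstar_algebra)"
  using star_add[of x "- x"] by (simp add: eq_neg_iff_add_eq_0 add.commute)

lemma star_diff: "star (x - y) = star x - star (y::'a::unital_cstar_algebra)"
  using star_add[of x "- y"] by (simp add: star_minus)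

lemma star_one [simp]: "star (1::'a::unital_cstar_algebra) = 1"
  using star_mult[of "star (1::'a)" 1] by (simp add: star_star)

lemma star_scaleR: "star (r *\<^sub>R x) = r *\<^sub>R star (x::'a::unital_cstar_algebra)"
  by (metis scaleC_of_real star_scaleC complex_cnj_complex_of_real)

lemmas star_simps = star_star star_add star_minus star_diff star_scaleR star_mult

lemma scaleC_minus_right: "c *\<^sub>C (- x) = - (c *\<^sub>C (x::'a::unital_cstar_algebra))"
proof -
  have "c *\<^sub>C (0::'a) = c *\<^sub>C 0 + c *\<^sub>C 0" by (simp add: scaleC_add_right[symmetric])
  then have "c *\<^sub>C (x + - x) = 0" by simp
  then show ?thesis unfolding scaleC_add_right by (simp add: eq_neg_iff_add_eq_0 add.commute)
qed

lemma ii_scaleC_mult: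
  "(\<i> *\<^sub>C x) * (\<i> *\<^sub>C y) = - (x * (y::'a::unital_cstar_algebra))"
proof -
  have "(\<i> *\<^sub>C x) * (\<i> *\<^sub>C y) = complex_of_real (-1) *\<^sub>C (x * y)"
    by (simp add: scaleC_mult_left scaleC_mult_right scaleC_scaleC)
  then show ?thesis by (simp only: scaleC_of_real) simp
qed

lemma star_ii_scaleC: "star (\<i> *\<^sub>C x) = - (\<i> *\<^sub>C star (x::'a::unital_cstar_algebra))"
proof -
  have "star (\<i> *\<^sub>C x) = complex_of_real (-1) *\<^sub>C (\<i> *\<^sub>C star x)"
    by (simp add: star_scaleC scaleC_scaleC)
  then show ?thesis by (simp only: scaleC_of_real) simp
qed

text \<open>The C*-identity bounds the square of \<open>norm y\<close> by
  \<open>norm (star y) * norm y\<close>; cancel, then take both \<open>x\<close> and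
  \<open>star x\<close> for \<open>y\<close>.\<close>

lemma norm_star: "norm (star x) = norm (x::'a::unital_cstar_algebra)"
proof -
  have le: "norm y \<le> norm (star y)" for y :: 'a
  proof (cases "norm y = 0")
    case False
    have "norm y * norm y \<le> norm (star y) * norm y"
      using norm_mult_ineq[of "star y" y] norm_star_mult_self[of y]
      by (simp add: power2_eq_square)
    then show ?thesis using False by simp
  qed simp
  show ?thesis using le[of x] le[of "star x"] by (simp add: star_star)
qed

lemma norm_one_le: "norm (1::'a::unital_cstar_algebra) \<le> 1"
proof -
  have "norm (1::'a) * norm (1::'a) = norm (1::'a)"
    using norm_star_mult_self[of "1::'a"] by (simp add: power2_eq_square)
  then show ?thesis by (auto simp: mult_cancel_right1)
qed

lemma star_mult_self_eq_0:
  fixes x :: "'a::unital_cstar_algebra"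
  assumes "star x * x = 0"
  shows "x = 0"
  using norm_star_mult_self[of x] assms by simp

lemma continuous_on_star [continuous_intros]:
  fixes f :: "'b::topological_space \<Rightarrow> 'a::unital_cstar_algebra"
  assumes "continuous_on S f"
  shows "continuous_on S (\<lambda>x. star (f x))"
proof -
  have "bounded_linear (star :: 'a \<Rightarrow> 'a)"
    by (rule bounded_linear_intro[of _ 1]) (simp_all add: star_simps norm_star)
  then show ?thesis using assms by (rule bounded_linear.continuous_on)
qed

section \<open>Inverses\<close>

text \<open>Fixed points of the contractions \<open>x \<mapsto> 1 + y * x\<close> and
  \<open>x \<mapsto> 1 + x * y\<close> replace the Neumann series; they are a right and a left
  inverse, hence equal.\<close>

lemma one_minus_invertible:
  fixes y :: "'a::unital_cstar_algebra"
  assumes "norm y < 1"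
  shows "\<exists>x. (1 - y) * x = 1 \<and> x * (1 - y) = 1"
proof -
  have "\<exists>!x\<in>UNIV. 1 + y * x = x"
  proof (rule Banach_fix[of UNIV "norm y"])
    show "\<And>u v. dist (1 + y * u) (1 + y * v) \<le> norm y * dist u v"
      by (simp add: dist_norm norm_mult_ineq right_diff_distrib[symmetric])
  qed (use assms in \<open>auto simp: complete_UNIV\<close>)
  then obtain x where x: "1 + y * x = x" by blast
  have "\<exists>!x\<in>UNIV. 1 + x * y = x"
  proof (rule Banach_fix[of UNIV "norm y"])
    show "\<And>u v. dist (1 + u * y) (1 + v * y) \<le> norm y * dist u v"
      by (simp add: dist_norm norm_mult_ineq left_diff_distrib[symmetric] mult.commute[of "norm y"])
  qed (use assms in \<open>auto simp: complete_UNIV\<close>)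
  then obtain z where z: "1 + z * y = z" by blast
  have r: "(1 - y) * x = 1" using x by (simp add: left_diff_distrib algebra_simps)
  have l: "z * (1 - y) = 1" using z by (simp add: right_diff_distrib algebra_simps)
  have "z = z * ((1 - y) * x)" using r by simp
  also have "\<dots> = x" using l by (simp add: mult.assoc[symmetric])
  finally show ?thesis using r l by blast
qed

lemma inverse_commutes:
  fixes r r' x :: "'a::unital_cstar_algebra"
  assumes "r * r' = 1" "r' * r = 1" "x * r = r * x"
  shows "x * r' = r' * x"
proof -
  have "x * r' = r' * (r * x) * r'" using assms(2) by (simp add: mult.assoc[symmetric])
  also have "\<dots> = r' * x * (r * r')" unfolding assms(3)[symmetric] by (simp add: mult.assoc)
  finally show ?thesis using assms(1) by simp
qed

lemma star_inverse:
  fixes r r' :: "'a::unital_cstar_algebra"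
  assumes "r * r' = 1" "r' * r = 1" "star r = r"
  shows "star r' = r'"
proof -
  have "star r' * r = 1" using arg_cong[OF assms(1), of star] assms(3) by (simp add: star_mult)
  then have "star r' * (r * r') = r'" by (simp add: mult.assoc[symmetric])
  then show ?thesis using assms(1) by simp
qed

section \<open>Positivity by norm bounds\<close>

text \<open>Spectrum-free stand-ins for positivity and strict positivity: a selfadjoint element has
  spectrum in \<open>{0..}\<close>, resp. \<open>{0<..}\<close>, exactly if it satisfies the following conditions.\<close>

definition cstar_nonneg :: "'a::unital_cstar_algebra \<Rightarrow> bool"
  where "cstar_nonneg c \<longleftrightarrow> star c = c \<and> (\<exists>t>0. norm (t *\<^sub>R 1 - c) \<le> t)"

definition cstar_pos :: "'a::unital_cstar_algebra \<Rightarrow> bool"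
  where "cstar_pos c \<longleftrightarrow> star c = c \<and> (\<exists>t>0. norm (t *\<^sub>R 1 - c) < t)"

lemma cstar_pos_scaleR:
  assumes "cstar_pos c" "r > 0"
  shows "cstar_pos (r *\<^sub>R c)"
proof -
  obtain t where t: "t > 0" "norm (t *\<^sub>R 1 - c) < t" and c: "star c = c"
    using assms(1) by (auto simp: cstar_pos_def)
  have "(r * t) *\<^sub>R 1 - r *\<^sub>R c = r *\<^sub>R (t *\<^sub>R 1 - c)" by (simp add: algebra_simps)
  then have "norm ((r * t) *\<^sub>R 1 - r *\<^sub>R c) < r * t" using t(2) assms(2) by simp
  then show ?thesis using t(1) assms(2) c unfolding cstar_pos_def
    by (intro conjI exI[of _ "r * t"]) (simp_all add: star_scaleR)
qed

lemma cstar_nonneg_scaleR: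
  assumes "cstar_nonneg c" "r > 0"
  shows "cstar_nonneg (r *\<^sub>R c)"
proof -
  obtain t where t: "t > 0" "norm (t *\<^sub>R 1 - c) \<le> t" and c: "star c = c"
    using assms(1) by (auto simp: cstar_nonneg_def)
  have "(r * t) *\<^sub>R 1 - r *\<^sub>R c = r *\<^sub>R (t *\<^sub>R 1 - c)" by (simp add: algebra_simps)
  then have "norm ((r * t) *\<^sub>R 1 - r *\<^sub>R c) \<le> r * t" using t(2) assms(2) by simp
  then show ?thesis using t(1) assms(2) c unfolding cstar_nonneg_def
    by (intro conjI exI[of _ "r * t"]) (simp_all add: star_scaleR)
qed

text \<open>The witnesses \<open>t\<close> and \<open>u\<close> add up by the triangle inequality
  alone.\<close>

lemma cstar_nonneg_add:
  assumes "cstar_nonneg c" "cstar_nonneg d"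
  shows "cstar_nonneg (c + d)"
proof -
  obtain t u where t: "t > 0" "norm (t *\<^sub>R 1 - c) \<le> t" and u: "u > 0" "norm (u *\<^sub>R 1 - d) \<le> u"
    and "star c = c" "star d = d"
    using assms by (auto simp: cstar_nonneg_def)
  moreover have "(t + u) *\<^sub>R 1 - (c + d) = (t *\<^sub>R 1 - c) + (u *\<^sub>R 1 - d)"
    by (simp add: algebra_simps)
  then have "norm ((t + u) *\<^sub>R 1 - (c + d)) \<le> t + u"
    using norm_triangle_mono[OF t(2) u(2)] by (simp only:)
  ultimately show ?thesis unfolding cstar_nonneg_def
    by (intro conjI exI[of _ "t + u"]) (simp_all add: star_add)
qed

lemma cstar_pos_add_scaleR:
  assumes "cstar_nonneg c" "\<delta> > 0"
  shows "cstar_pos (\<delta> *\<^sub>R 1 + c)"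
proof -
  obtain t where "norm (t *\<^sub>R 1 - c) \<le> t" and "t > 0" "star c = c"
    using assms(1) by (auto simp: cstar_nonneg_def)
  moreover have "(t + \<delta>) *\<^sub>R 1 - (\<delta> *\<^sub>R 1 + c) = t *\<^sub>R 1 - c" by (simp add: algebra_simps)
  ultimately have "norm ((t + \<delta>) *\<^sub>R 1 - (\<delta> *\<^sub>R 1 + c)) < t + \<delta>"
    using assms(2) by (metis add_strict_increasing2 le_less_trans less_add_same_cancel1)
  then show ?thesis using \<open>t > 0\<close> \<open>star c = c\<close> assms(2) unfolding cstar_pos_def
    by (intro conjI exI[of _ "t + \<delta>"]) (simp_all add: star_simps)
qed

text \<open>Multiplying \<open>t *\<^sub>R 1 + p\<close> by \<open>p\<close> gives
  \<open>(t + 1) *\<^sub>R p\<close>, whose norm exceeds \<open>t * norm p\<close> unless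
  \<open>p = 0\<close>.\<close>

lemma projection_eq_0_if_neg_nonneg:
  fixes p :: "'a::unital_cstar_algebra"
  assumes "is_projection p" "cstar_nonneg (- p)"
  shows "p = 0"
proof -
  obtain t where t: "t > 0" "norm (t *\<^sub>R 1 + p) \<le> t"
    using assms(2) by (auto simp: cstar_nonneg_def)
  have "(t *\<^sub>R 1 + p) * p = (t + 1) *\<^sub>R p"
    using assms(1) by (simp add: is_projection_def algebra_simps)
  then have "(t + 1) * norm p \<le> norm (t *\<^sub>R 1 + p) * norm p"
    using norm_mult_ineq[of "t *\<^sub>R 1 + p" p] t(1) by simp
  also have "\<dots> \<le> t * norm p" using t(2) by (intro mult_right_mono) auto
  finally show ?thesis by (simp add: distrib_right)
qed

section \<open>Square roots and squares\<close>

text \<open>If \<open>z\<close> is a fixed point of \<open>z \<mapsto> (y + z\<^sup>2) / 2\<close>, then \<open>(1 - z)\<^sup>2 = 1 - y\<close>.\<close>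

lemma sqrt_exists_near_one:
  fixes c :: "'a::unital_cstar_algebra"
  assumes c: "star c = c" "norm (1 - c) < 1"
  shows "\<exists>r. star r = r \<and> norm (1 - r) < 1 \<and> r * r = c \<and> (\<forall>x. x * c = c * x \<longrightarrow> x * r = r * x)"
proof -
  define y where "y = 1 - c"
  define \<rho> where "\<rho> = norm y"
  have \<rho>: "0 \<le> \<rho>" "\<rho> < 1" using c by (simp_all add: \<rho>_def y_def)
  have sy: "star y = y" using c by (simp add: y_def star_diff)
  \<comment> \<open>Selfadjointness and commuting with the commutant of \<open>c\<close> are closed
    conditions preserved by \<open>f\<close>; building them into the domain passes them on to the
    fixed point.\<close>
  define S where "S = {z. norm z \<le> \<rho> \<and> star z = z \<and> (\<forall>x. x * c = c * x \<longrightarrow> x * z = z * x)}"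
  have S_norm: "norm z \<le> \<rho>" and S_star: "star z = z" if "z \<in> S" for z
    using that unfolding S_def by blast+
  define f where "f z = (1/2) *\<^sub>R (y + z * z)" for z
  have "S = cball 0 \<rho> \<inter> {z. star z = z} \<inter> (\<Inter>x\<in>{x. x * c = c * x}. {z. x * z = z * x})"
    by (auto simp: S_def)
  moreover have "closed \<dots>"
    by (intro closed_Int closed_INT closed_cball ballI closed_Collect_eq continuous_intros)
  ultimately have "complete S" by (simp add: complete_eq_closed)
  moreover have "S \<noteq> {}" using \<rho> by (auto simp: S_def intro!: exI[of _ 0])
  moreover have "f ` S \<subseteq> S"
  proof (rule image_subsetI)
    fix z assume z: "z \<in> S"
    have "norm (z * z) \<le> norm z * norm z" by (rule norm_mult_ineq)
    also have "\<dots> \<le> \<rho> * \<rho>" using S_norm[OF z] \<rho> by (intro mult_mono) auto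
    also have "\<dots> \<le> \<rho>" using \<rho> by (simp add: mult_left_le)
    finally have "norm (y + z * z) \<le> 2 * \<rho>"
      using norm_triangle_ineq[of y "z * z"] by (simp add: \<rho>_def)
    moreover have "x * f z = f z * x" if "x * c = c * x" for x
    proof -
      have xz: "x * z = z * x" using z that unfolding S_def by blast
      have "x * (z * z) = z * z * x" by (metis mult.assoc xz)
      then show ?thesis using that by (simp add: f_def y_def algebra_simps)
    qed
    moreover have "star (f z) = f z" using S_star[OF z] sy by (simp add: f_def star_simps)
    moreover have "norm (f z) = norm (y + z * z) / 2" by (simp add: f_def)
    ultimately show "f z \<in> S" unfolding S_def by auto
  qed
  moreover have "dist (f u) (f v) \<le> \<rho> * dist u v" if "u \<in> S" "v \<in> S" for u v
  proof -
    have "f u - f v = (1/2) *\<^sub>R (u * (u - v) + (u - v) * v)"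
      by (simp add: f_def algebra_simps)
    then have "norm (f u - f v) = norm (u * (u - v) + (u - v) * v) / 2" by simp
    also have "norm (u * (u - v) + (u - v) * v) \<le> norm u * norm (u - v) + norm (u - v) * norm v"
      by (intro norm_triangle_mono norm_mult_ineq)
    also have "\<dots> \<le> \<rho> * norm (u - v) + norm (u - v) * \<rho>"
      using S_norm that by (intro add_mono mult_mono) (auto simp: \<rho>)
    finally show ?thesis by (simp add: dist_norm)
  qed
  ultimately obtain z where z: "z \<in> S" "f z = z"
    using Banach_fix[of S \<rho> f] \<rho> by blast
  have "z * z = 2 *\<^sub>R f z - y" by (simp add: f_def)
  then have "z * z = 2 *\<^sub>R z - y" using z(2) by simp
  then have "(1 - z) * (1 - z) = c" by (simp add: y_def algebra_simps scaleR_2)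
  moreover have "x * (1 - z) = (1 - z) * x" if "x * c = c * x" for x
  proof -
    have "x * z = z * x" using z(1) that unfolding S_def by blast
    then show ?thesis by (simp add: algebra_simps)
  qed
  moreover have "star (1 - z) = 1 - z" "norm (1 - (1 - z)) < 1"
    using S_norm[OF z(1)] S_star[OF z(1)] \<rho> by (auto simp: star_diff)
  ultimately show ?thesis by blast
qed

text \<open>Scaling by \<open>1/t\<close> moves \<open>c\<close> into the open unit ball around 1;
  the root found there lies in the same ball and is therefore invertible.\<close>

lemma cstar_pos_sqrt:
  fixes c :: "'a::unital_cstar_algebra"
  assumes "cstar_pos c"
  obtains r r' where "cstar_pos r" "star r = r" "r * r = c" "r * r' = 1" "r' * r = 1"
    "\<And>x. x * c = c * x \<Longrightarrow> x * r = r * x"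
proof -
  obtain t where t: "t > 0" "norm (t *\<^sub>R 1 - c) < t" and c: "star c = c"
    using assms by (auto simp: cstar_pos_def)
  have "1 - (1/t) *\<^sub>R c = (1/t) *\<^sub>R (t *\<^sub>R 1 - c)" using t(1) by (simp add: algebra_simps)
  then have "norm (1 - (1/t) *\<^sub>R c) < 1" using t by simp
  moreover have "star ((1/t) *\<^sub>R c) = (1/t) *\<^sub>R c" using c by (simp add: star_scaleR)
  ultimately obtain r where r: "star r = r" "norm (1 - r) < 1" "r * r = (1/t) *\<^sub>R c"
    and comm: "\<And>x. x * ((1/t) *\<^sub>R c) = ((1/t) *\<^sub>R c) * x \<Longrightarrow> x * r = r * x"
    using sqrt_exists_near_one by metis
  obtain r' where r': "r * r' = 1" "r' * r = 1" using one_minus_invertible[OF r(2)] by auto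
  have "cstar_pos r" unfolding cstar_pos_def using r by (intro conjI exI[of _ 1]) auto
  show thesis
  proof
    show "cstar_pos (sqrt t *\<^sub>R r)" using \<open>cstar_pos r\<close> t by (simp add: cstar_pos_scaleR)
    show "star (sqrt t *\<^sub>R r) = sqrt t *\<^sub>R r" by (simp add: star_scaleR r)
    show "(sqrt t *\<^sub>R r) * (sqrt t *\<^sub>R r) = c" using t r by simp
    show "(sqrt t *\<^sub>R r) * ((1 / sqrt t) *\<^sub>R r') = 1" "((1 / sqrt t) *\<^sub>R r') * (sqrt t *\<^sub>R r) = 1"
      using t r' by simp_all
    show "x * (sqrt t *\<^sub>R r) = (sqrt t *\<^sub>R r) * x" if "x * c = c * x" for x
      using comm[of x] that by simp
  qed
qed

lemma cstar_pos_inverse: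
  fixes c :: "'a::unital_cstar_algebra"
  assumes "cstar_pos c"
  obtains c' where "c * c' = 1" "c' * c = 1"
proof -
  obtain r r' where r: "r * r = c" "r * r' = 1" "r' * r = 1" using cstar_pos_sqrt[OF assms] by metis
  have "c * (r' * r') = 1" "(r' * r') * c = 1"
    unfolding r(1)[symmetric]
    by (simp_all add: mult.assoc r(2,3) r(2,3)[THEN mult_eq_reassoc])
  then show thesis by (rule that)
qed

text \<open>If \<open>\<parallel>s\<parallel> < 1\<close> and \<open>r\<close> is the square root of \<open>1 - s\<^sup>2\<close>, then \<open>s + \<i>r\<close> is unitary; hence
  \<open>r\<close>, its imaginary part, is a contraction.\<close>

lemma norm_one_minus_square_le:
  fixes s :: "'a::unital_cstar_algebra"
  assumes s: "star s = s" "norm s < 1"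
  shows "norm (1 - s * s) \<le> 1"
proof -
  have "norm (s * s) \<le> norm s * norm s" by (rule norm_mult_ineq)
  also have "\<dots> < 1" using s(2) by (metis mult_strict_mono' norm_ge_zero mult_1)
  finally have "norm (1 - (1 - s * s)) < 1" by simp
  moreover have "star (1 - s * s) = 1 - s * s" using s by (simp add: star_simps)
  ultimately obtain r where r: "star r = r" "r * r = 1 - s * s"
    and comm: "\<And>x. x * (1 - s * s) = (1 - s * s) * x \<Longrightarrow> x * r = r * x"
    using sqrt_exists_near_one by metis
  have sr: "s * r = r * s" by (rule comm) (simp add: algebra_simps)
  define u where "u = s + \<i> *\<^sub>C r"
  have su: "star u = s - \<i> *\<^sub>C r" by (simp add: u_def star_add star_ii_scaleC s r)
  have "star u * u = s * s + s * (\<i> *\<^sub>C r) - (\<i> *\<^sub>C r) * s - (\<i> *\<^sub>C r) * (\<i> *\<^sub>C r)"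
    unfolding su unfolding u_def by (simp only: left_diff_distrib distrib_left) simp
  also have "\<dots> = s * s + r * r"
    unfolding ii_scaleC_mult by (simp add: scaleC_mult_left scaleC_mult_right sr)
  finally have "star u * u = s * s + r * r" .
  then have "star u * u = 1" using r by simp
  then have "(norm u)\<^sup>2 \<le> 1" using norm_star_mult_self[of u] norm_one_le by metis
  then have "norm u \<le> 1" by (simp add: power_le_one_iff)
  moreover have "2 *\<^sub>R (\<i> *\<^sub>C r) = u - star u" unfolding su by (simp add: u_def scaleR_2)
  then have "2 * norm r = norm (u - star u)"
    by (metis norm_scaleR norm_scaleC norm_ii mult_1 abs_numeral real_norm_def)
  ultimately have "norm r \<le> 1"
    using norm_triangle_ineq4[of u "star u"] by (simp add: norm_star)
  then have "norm r * norm r \<le> 1" by (simp add: mult_le_one)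
  then show ?thesis using norm_mult_ineq[of r r] r by simp
qed

text \<open>Division by \<open>t > norm s\<close> reduces to the contraction bound just
  proved.\<close>

lemma cstar_nonneg_square:
  fixes s :: "'a::unital_cstar_algebra"
  assumes "star s = s"
  shows "cstar_nonneg (s * s)"
proof -
  define t where "t = norm s + 1"
  have t: "t > 0" "norm s < t" by (auto simp: t_def add_nonneg_pos)
  have "norm (1 - ((1/t) *\<^sub>R s) * ((1/t) *\<^sub>R s)) \<le> 1"
    by (rule norm_one_minus_square_le) (use assms t in \<open>simp_all add: star_scaleR\<close>)
  then have "cstar_nonneg (((1/t) *\<^sub>R s) * ((1/t) *\<^sub>R s))"
    unfolding cstar_nonneg_def using assms
    by (intro conjI exI[of _ 1]) (simp_all add: star_simps)
  from cstar_nonneg_scaleR[OF this, of "t * t"] show ?thesis using t by simp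
qed

text \<open>The inverse \<open>w\<close> keeps \<open>s * s\<close> away from 0: with
  \<open>r\<close> a root of \<open>1 - \<delta> *\<^sub>R (w * w)\<close>, it equals
  \<open>\<delta> *\<^sub>R 1\<close> plus the square of the selfadjoint
  \<open>s * r\<close>.\<close>

lemma cstar_pos_square:
  fixes s :: "'a::unital_cstar_algebra"
  assumes s: "star s = s" "s * w = 1" "w * s = 1"
  shows "cstar_pos (s * s)"
proof -
  have sw: "star w = w" using star_inverse s by metis
  define \<delta> where "\<delta> = 1 / (norm (w * w) + 1)"
  have \<delta>: "\<delta> > 0" by (simp add: \<delta>_def add_nonneg_pos)
  have "\<delta> * norm (w * w) < 1" by (simp add: \<delta>_def divide_simps add_nonneg_pos)
  then have "norm (1 - (1 - \<delta> *\<^sub>R (w * w))) < 1" using \<delta> by simp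
  moreover have "star (1 - \<delta> *\<^sub>R (w * w)) = 1 - \<delta> *\<^sub>R (w * w)" using sw by (simp add: star_simps)
  ultimately obtain r where r: "star r = r" "r * r = 1 - \<delta> *\<^sub>R (w * w)"
    and comm: "\<And>x. x * (1 - \<delta> *\<^sub>R (w * w)) = (1 - \<delta> *\<^sub>R (w * w)) * x \<Longrightarrow> x * r = r * x"
    using sqrt_exists_near_one by metis
  have "s * (w * w) = (w * w) * s" by (simp add: mult.assoc s s(2)[THEN mult_eq_reassoc])
  then have sr: "s * r = r * s" by (intro comm) (simp add: algebra_simps)
  have "(s * r) * (s * r) = s * (r * r) * s" by (metis mult.assoc sr)
  also have "\<dots> = s * s - \<delta> *\<^sub>R 1"
    by (simp add: r left_diff_distrib right_diff_distrib mult.assoc s s(2)[THEN mult_eq_reassoc])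
  finally have eq: "s * s = \<delta> *\<^sub>R 1 + (s * r) * (s * r)" by simp
  have "star (s * r) = s * r" by (simp add: star_mult s r sr)
  then show ?thesis unfolding eq
    by (intro cstar_pos_add_scaleR cstar_nonneg_square \<delta>)
qed

lemma cstar_pos_inverse_pos:
  fixes c :: "'a::unital_cstar_algebra"
  assumes "cstar_pos c" "c * k = 1" "k * c = 1"
  shows "cstar_pos k"
proof -
  obtain r r' where r: "star r = r" "r * r = c" "r * r' = 1" "r' * r = 1"
    using cstar_pos_sqrt[OF assms(1)] by metis
  have "c * (r' * r') = 1"
    unfolding r(2)[symmetric] by (simp add: mult.assoc r(3) r(3)[THEN mult_eq_reassoc])
  then have "k = r' * r'" using mult_eq_reassoc[OF assms(3), of "r' * r'"] by simp
  moreover have "cstar_pos (r' * r')"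
    using star_inverse[OF r(3,4,1)] r by (intro cstar_pos_square[of _ r])
  ultimately show ?thesis by simp
qed

section \<open>Positivity of \<open>star h * h\<close>\<close>

text \<open>With \<open>y = a + \<i>b\<close> one has \<open>y\<^sup>*y + yy\<^sup>* = 2(a\<^sup>2 + b\<^sup>2)\<close>, while \<open>-yy\<^sup>*\<close> is a projection too.\<close>

lemma star_mult_self_neg_projection:
  fixes y p :: "'a::unital_cstar_algebra"
  assumes p: "is_projection p" and y: "star y * y = - p" "y * p = y"
  shows "p = 0"
proof -
  define q where "q = - (y * star y)"
  have "q * q = y * (star y * y) * star y" by (simp add: q_def mult.assoc)
  also have "\<dots> = q" by (simp add: y q_def)
  finally have q: "q * q = q" "star q = q" by (simp_all add: q_def star_simps)
  \<comment> \<open>Here \<open>a\<close> is twice the real part of \<open>y\<close>, and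
    \<open>b\<close> is minus twice its imaginary part.\<close>
  define a where "a = y + star y"
  define b where "b = \<i> *\<^sub>C (y - star y)"
  have sa: "star a = a" by (simp add: a_def star_simps add.commute)
  have sb: "star b = b"
    unfolding b_def star_ii_scaleC by (simp add: star_simps scaleC_minus_right[symmetric])
  have "a * a + b * b = 2 *\<^sub>R (star y * y + y * star y)"
    by (simp add: a_def b_def ii_scaleC_mult algebra_simps scaleR_2)
  \<comment> \<open>Since \<open>y * star y = - q\<close> and \<open>q * q = q\<close>, the added
    term cancels and leaves a multiple of \<open>- p\<close> as a sum of squares.\<close>
  then have eq: "a * a + b * b + 2 *\<^sub>R (q * q) = 2 *\<^sub>R (- p)"
    unfolding q(1) by (simp add: y q_def scaleR_diff_right)
  have "cstar_nonneg (a * a + b * b + 2 *\<^sub>R (q * q))"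
    using sa sb q by (intro cstar_nonneg_add cstar_nonneg_scaleR cstar_nonneg_square) auto
  then have "cstar_nonneg ((1/2) *\<^sub>R (2 *\<^sub>R (- p)))"
    unfolding eq by (rule cstar_nonneg_scaleR) simp
  then show ?thesis using projection_eq_0_if_neg_nonneg[OF p] by simp
qed

text \<open>With \<open>s = g\<^sup>*g\<close> and \<open>m = |s|\<close>, the projection \<open>p\<close> is the negative spectral
  projection of \<open>s\<close>.\<close>

lemma cstar_pos_star_mult_self:
  fixes g k :: "'a::unital_cstar_algebra"
  assumes k: "(star g * g) * k = 1" "k * (star g * g) = 1"
  shows "cstar_pos (star g * g)"
proof -
  define s where "s = star g * g"
  have ss: "star s = s" by (simp add: s_def star_simps)
  have "cstar_pos (s * s)" using ss k by (intro cstar_pos_square[of _ k]) (simp_all add: s_def)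
  then obtain m m' where m: "cstar_pos m" "star m = m" "m * m = s * s" "m * m' = 1" "m' * m = 1"
    and mc: "\<And>x. x * (s * s) = (s * s) * x \<Longrightarrow> x * m = m * x"
    using cstar_pos_sqrt by metis
  obtain n n' where n: "star n = n" "n * n = m" "n * n' = 1" "n' * n = 1"
    and nc: "\<And>x. x * m = m * x \<Longrightarrow> x * n = n * x"
    using cstar_pos_sqrt[OF m(1)] by metis
  have sn': "star n' = n'" using star_inverse n by metis
  have sm: "s * m = m * s" by (rule mc) (simp add: mult.assoc)
  have smm: "s * m' = m' * s" by (rule inverse_commutes[OF m(4,5) sm])
  have snn: "s * n' = n' * s" by (rule inverse_commutes[OF n(3,4) nc[OF sm]])
  have m'm: "m' * m = m * m'" by (simp add: m)
  have m'n': "m' * n' = n' * m'" by (rule inverse_commutes[OF n(3,4) nc[OF m'm]])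
  have sm': "star m' = m'" using star_inverse m by metis
  have n'n': "n' * n' = m'"
  proof -
    have "m * (n' * n') = 1"
      unfolding n(2)[symmetric] by (simp add: mult.assoc n(3) n(3)[THEN mult_eq_reassoc])
    then show ?thesis using mult_eq_reassoc[OF m(5), of "n' * n'"] by simp
  qed
  \<comment> \<open>The sign of \<open>s\<close>, a selfadjoint unitary.\<close>
  define e where "e = s * m'"
  have "e * e = s * s * m' * m'" by (metis e_def mult.assoc smm)
  also have "\<dots> = 1" unfolding m(3)[symmetric] by (simp add: mult.assoc m(4) m(4)[THEN mult_eq_reassoc])
  finally have ee: "e * e = 1" .
  have se: "star e = e" by (simp add: e_def star_mult ss sm' smm)
  have en': "e * n' = n' * e" unfolding e_def by (metis mult.assoc snn m'n')
  define p where "p = (1/2) *\<^sub>R (1 - e)"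
  have p: "p * p = p" "star p = p" "p * e = - p" "p * n' = n' * p"
    using ee se en' by (simp_all add: p_def star_simps algebra_simps)
      (simp_all add: scaleR_add_left[symmetric])
  have ps: "p * s = s * p"
    by (simp add: p_def e_def algebra_simps) (metis mult.assoc smm)
  \<comment> \<open>The factor \<open>n'\<close>, which is \<open>m\<close> to the power -1/2,
    normalises \<open>p * s * p\<close> to \<open>p * e = - p\<close>.\<close>
  define y where "y = g * p * n'"
  have "star y * y = n' * p * s * p * n'"
    by (simp add: y_def star_mult p sn' s_def mult.assoc)
  also have "\<dots> = p * (s * (n' * n'))" by (metis mult.assoc p(1,4) ps snn)
  also have "\<dots> = - p" using p by (simp add: n'n' e_def)
  finally have "star y * y = - p" .
  moreover have "y * p = y" unfolding y_def by (metis mult.assoc p(1,4))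
  ultimately have "p = 0" using star_mult_self_neg_projection p by (metis is_projection_def)
  then have "e = 1" by (simp add: p_def)
  then have "s = m" unfolding e_def using m by (metis mult.assoc mult_1_left mult_1_right)
  then show ?thesis using m by (simp add: s_def)
qed

text \<open>The idempotent \<open>e = hl\<close> is replaced by its range projection \<open>q = ee\<^sup>*z\<^sup>-\<^sup>1\<close>, where
  \<open>z = 1 + (e - e\<^sup>*)\<^sup>*(e - e\<^sup>*)\<close>.\<close>

lemma left_invertible_star_mult_self_invertible:
  fixes h l :: "'a::unital_cstar_algebra"
  assumes lh: "l * h = 1"
  obtains k where "(star h * h) * k = 1" "k * (star h * h) = 1"
proof -
  define e where "e = h * l"
  have ee: "e * e = e" unfolding e_def by (simp add: mult.assoc lh[THEN mult_eq_reassoc])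
  then have ss: "star e * star e = star e" by (metis star_mult)
  note E = ee ss ee[THEN mult_eq_reassoc] ss[THEN mult_eq_reassoc]
  \<comment> \<open>The factor \<open>\<i>\<close> makes \<open>e - star e\<close> selfadjoint, so
    \<open>d * d\<close> is nonnegative and \<open>z\<close> invertible.\<close>
  define d where "d = \<i> *\<^sub>C (e - star e)"
  define z where "z = 1 *\<^sub>R 1 + d * d"
  have sd: "star d = d"
    unfolding d_def star_ii_scaleC by (simp add: star_simps scaleC_minus_right[symmetric])
  have "cstar_pos z" unfolding z_def using sd by (intro cstar_pos_add_scaleR cstar_nonneg_square) auto
  then obtain z' where z': "z * z' = 1" "z' * z = 1" using cstar_pos_inverse by metis
  have z_eq: "z = 1 - e - star e + e * star e + star e * e"
    by (simp add: z_def d_def ii_scaleC_mult algebra_simps E)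
  have sz: "star z = z" by (simp add: z_eq star_simps)
  have sz': "star z' = z'" using star_inverse z' sz by metis
  have ez: "e * z = e * star e * e" "z * e = e * star e * e"
    by (simp_all add: z_eq algebra_simps E)
  have ez': "e * z' = z' * e" by (rule inverse_commutes[OF z']) (simp add: ez)
  have sez: "star e * z = z * star e" by (metis ez star_mult sz)
  have sez': "star e * z' = z' * star e" by (rule inverse_commutes[OF z' sez])
  define q where "q = e * star e * z'"
  have qe: "q * e = e"
  proof -
    have "q * e = e * star e * e * z'" unfolding q_def by (simp add: mult.assoc ez')
    also have "\<dots> = e * (z * z')" unfolding ez(1)[symmetric] by (simp add: mult.assoc)
    finally show ?thesis by (simp add: z')
  qed
  have eq: "e * q = q" by (simp add: q_def mult.assoc E)
  have sq: "star q = q" unfolding q_def by (simp add: star_simps sz') (metis mult.assoc ez' sez')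
  have qh: "q * h = h" using qe lh unfolding e_def by (metis mult.assoc mult_1_right)
  \<comment> \<open>Inserting \<open>q\<close> makes \<open>h * l'\<close> selfadjoint, so that
    \<open>l' * star l'\<close> inverts \<open>star h * h\<close>.\<close>
  define l' where "l' = l * q"
  have l'h: "l' * h = 1" by (simp add: l'_def mult.assoc qh lh)
  have hl': "h * l' = q" using eq by (simp add: l'_def e_def mult.assoc)
  have 1: "(star h * h) * (l' * star l') = 1"
  proof -
    have "(star h * h) * (l' * star l') = star h * (h * l') * star l'" by (simp add: mult.assoc)
    also have "\<dots> = star (l' * (q * h))" by (simp add: hl' star_mult sq mult.assoc)
    finally show ?thesis by (simp add: qh l'h)
  qed
  moreover have "(l' * star l') * (star h * h) = 1"
    using arg_cong[OF 1, of star] by (simp add: star_simps mult.assoc)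
  ultimately show thesis by (rule that)
qed

section \<open>Projections and invertibility up to a pair\<close>

text \<open>For \<open>x = v - p * v\<close>, \<open>x * star x = (1 - p) * p * (1 - p) = 0\<close>,
  so \<open>x = 0\<close> by the C*-identity.\<close>

lemma partial_isometry:
  fixes v p :: "'a::unital_cstar_algebra"
  assumes p: "is_projection p" and v: "v * star v = p"
  shows "p * v = v" "star v * p = star v"
proof -
  have "star (star (v - p * v)) * star (v - p * v) = 0"
    using p v v[THEN mult_eq_reassoc]
    by (simp add: star_simps is_projection_def algebra_simps)
  then have "star (v - p * v) = 0" by (rule star_mult_self_eq_0)
  then have "star (star (v - p * v)) = 0" by simp
  then show "p * v = v" by (simp add: star_star)
  then show "star v * p = star v" using p by (metis star_mult is_projection_def)
qed

lemma is_projection_one_minus: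
  "is_projection p \<Longrightarrow> is_projection (1 - p)" for p :: "'a::unital_cstar_algebra"
  by (simp add: is_projection_def star_diff algebra_simps)

text \<open>Here \<open>p' = vv\<^sup>*\<close> is the range projection of \<open>h(h\<^sup>*h)\<^sup>-\<^sup>1p\<close>, and \<open>1 - q = hl - p'\<close> is that of
  \<open>h(1 - p)\<close>.\<close>

lemma left_invertible_invertible_up_to:
  fixes a h l p :: "'a::unital_cstar_algebra"
  assumes lh: "l * h = 1" and p: "is_projection p" and ah: "a * (1 - p) = h * (1 - p)"
  obtains p' q where "is_projection p'" "is_projection q" "proj_le p' q" "proj_equiv p p'"
    "p' \<in> range (\<lambda>x. x * p * star x)" "invertible_up_to a p q"
    "\<And>r. h * r = 1 \<Longrightarrow> q = p'"
proof -
  obtain k where k: "(star h * h) * k = 1" "k * (star h * h) = 1"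
    using left_invertible_star_mult_self_invertible[OF lh] .
  have kpos: "cstar_pos k"
    by (rule cstar_pos_inverse_pos[OF cstar_pos_star_mult_self[OF k] k])
  then obtain t where t: "t > 0" "norm (t *\<^sub>R 1 - k) < t" and sk: "star k = k"
    by (auto simp: cstar_pos_def)
  have pp: "p * p = p" "star p = p" using p by (simp_all add: is_projection_def)
  note P = pp pp(1)[THEN mult_eq_reassoc]
  have np: "norm p \<le> 1"
  proof -
    have "norm p * norm p = norm p"
      using norm_star_mult_self[of p] pp by (simp add: power2_eq_square)
    then show ?thesis by (auto simp: mult_cancel_right1)
  qed
  \<comment> \<open>The summand on \<open>1 - p\<close> makes the compression of \<open>k\<close>
    invertible in the whole algebra; using the \<open>t\<close> of \<open>k\<close> turns
    \<open>t *\<^sub>R 1 - w\<close> into a compression of \<open>t *\<^sub>R 1 - k\<close>.\<close>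
  define w where "w = p * k * p + t *\<^sub>R (1 - p)"
  have sw: "star w = w" by (simp add: w_def star_simps pp sk mult.assoc)
  have "t *\<^sub>R 1 - w = p * (t *\<^sub>R 1 - k) * p" by (simp add: w_def algebra_simps P)
  also have "norm \<dots> \<le> norm p * norm (t *\<^sub>R 1 - k) * norm p"
    by (meson norm_mult_ineq order_trans mult_right_mono norm_ge_zero)
  also have "\<dots> \<le> 1 * norm (t *\<^sub>R 1 - k) * 1"
    using np by (intro mult_mono) auto
  also have "\<dots> < t" using t by simp
  finally have "cstar_pos w" using t sw by (auto simp: cstar_pos_def)
  then obtain r r' where r: "star r = r" "r * r = w" "r * r' = 1" "r' * r = 1"
    and rc: "\<And>x. x * w = w * x \<Longrightarrow> x * r = r * x"
    using cstar_pos_sqrt by metis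
  have sr': "star r' = r'" using star_inverse r by metis
  have pw: "p * w = p * k * p" "w * p = p * k * p" by (simp_all add: w_def algebra_simps P)
  have pr: "p * r = r * p" by (rule rc) (simp add: pw)
  have pr': "p * r' = r' * p" by (rule inverse_commutes[OF r(3,4) pr])
  \<comment> \<open>With this left inverse \<open>h * l0\<close> is selfadjoint: it is the range
    projection of \<open>h\<close>.\<close>
  define l0 where "l0 = k * star h"
  have l0h: "l0 * h = 1" using k by (simp add: l0_def mult.assoc)
  \<comment> \<open>With \<open>x = h * k * p\<close>, \<open>star x * x = p * k * p\<close>; as
    \<open>r'\<close> is the inverse root of \<open>w\<close>, \<open>v\<close> is the partial
    isometry in the polar decomposition of \<open>x\<close>.\<close>
  define v where "v = h * k * p * r'"
  define p' where "p' = v * star v"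
  have vp: "v * p = v" by (simp add: v_def mult.assoc pr'[symmetric] P)
  have vr: "v * r = h * k * p" by (simp add: v_def mult.assoc r)
  have svv: "star v * v = p"
  proof -
    have "star v * v = r' * p * (k * (star h * h)) * k * p * r'"
      by (simp add: v_def star_mult sr' sk pp mult.assoc)
    also have "\<dots> = r' * (p * k * p) * r'" by (simp add: k mult.assoc)
    also have "\<dots> = r' * (r * (r * p)) * r'" unfolding pw(2)[symmetric] r(2)[symmetric] by (simp add: mult.assoc)
    also have "\<dots> = p"
      by (simp add: mult.assoc pr' r(3,4) r(4)[THEN mult_eq_reassoc] r(3)[THEN mult_eq_reassoc])
    finally show ?thesis .
  qed
  have p'v: "p' * v = v" by (simp add: p'_def mult.assoc svv vp)
  have p'proj: "p' * p' = p'" "star p' = p'"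
    by (simp add: p'_def mult.assoc svv[THEN mult_eq_reassoc] vp vp[THEN mult_eq_reassoc])
      (simp add: p'_def star_simps)
  have p'x: "p' * (h * k * p) = h * k * p"
    unfolding vr[symmetric] by (simp add: mult.assoc[symmetric] p'v)
  have pl: "p * l0 * p' = p * l0"
    using arg_cong[OF p'x, of star] by (simp add: star_mult p'proj pp sk l0_def mult.assoc)
  define e where "e = h * l0"
  have e: "e * e = e" "star e = e" "e * h = h" "l0 * e = l0"
    by (simp_all add: e_def mult.assoc l0h l0h[THEN mult_eq_reassoc])
      (simp add: l0_def star_simps sk mult.assoc)
  have ev: "e * v = v" by (simp add: v_def mult.assoc e(3)[THEN mult_eq_reassoc])
  have ep': "e * p' = p'" by (simp add: p'_def mult.assoc[symmetric] ev)
  then have p'e: "p' * e = p'" by (metis star_mult p'proj(2) e(2))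
  \<comment> \<open>The ranges of \<open>p'\<close> and \<open>h * (1 - p)\<close> are orthogonal,
    because \<open>p' * h\<close> reduces to \<open>v * r' * p\<close>.\<close>
  have p'h: "p' * h * (1 - p) = 0"
  proof -
    have "p' * h = v * (r' * p * (k * (star h * h)))"
      by (simp add: p'_def v_def star_mult sr' sk pp mult.assoc)
    also have "\<dots> = v * r' * p" by (simp add: k mult.assoc)
    finally show ?thesis by (simp add: mult.assoc right_diff_distrib P)
  qed
  define q where "q = 1 - (e - p')"
  have q: "is_projection q"
    unfolding q_def is_projection_def by (simp add: star_simps e p'proj algebra_simps ep' p'e)
  have qc: "1 - q = e - p'" by (simp add: q_def)
  have qh: "(1 - q) * h * (1 - p) = h * (1 - p)"
    unfolding qc using p'h by (simp add: left_diff_distrib e)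
  have plq: "p * l0 * (1 - q) = 0"
    unfolding qc using pl by (simp add: right_diff_distrib mult.assoc e)
  define b where "b = (1 - p) * l0 * (1 - q)"
  have b: "b = l0 * (1 - q)" using plq by (simp add: b_def left_diff_distrib)
  have qq: "(1 - q) * (1 - q) = 1 - q" "(1 - p) * (1 - p) = 1 - p"
    using is_projection_one_minus[OF q] is_projection_one_minus[OF p]
    by (simp_all add: is_projection_def)
  have a': "(1 - q) * a * (1 - p) = h * (1 - p)"
    using qh ah by (simp add: mult.assoc)
  have "invertible_up_to a p q"
    unfolding invertible_up_to_def Let_def a'
  proof (intro exI[of _ b] conjI)
    show "b = (1 - p) * b * (1 - q)"
      unfolding b_def by (simp add: mult.assoc qq qq(2)[THEN mult_eq_reassoc])
    have "h * (1 - p) * b = h * ((1 - p) * (1 - p)) * l0 * (1 - q)" by (simp add: b_def mult.assoc)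
    also have "\<dots> = h * b" by (simp add: qq b_def mult.assoc)
    also have "\<dots> = e * (1 - q)" by (simp add: b e_def mult.assoc)
    also have "\<dots> = 1 - q" unfolding qc by (simp add: right_diff_distrib e ep')
    finally show "h * (1 - p) * b = 1 - q" .
    have "b * (h * (1 - p)) = (1 - p) * l0 * ((1 - q) * h * (1 - p))"
      by (simp add: b_def mult.assoc)
    also have "\<dots> = (1 - p) * (l0 * h) * (1 - p)" unfolding qh by (simp add: mult.assoc)
    finally show "b * (h * (1 - p)) = 1 - p" by (simp add: l0h qq)
  qed
  moreover have "proj_le p' q"
    by (simp add: proj_le_def q_def right_diff_distrib p'e p'proj)
  moreover have "proj_equiv p p'"
    unfolding proj_equiv_def using svv by (intro exI[of _ "star v"]) (simp add: p'_def star_star)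
  moreover have "p' = v * p * star v" by (simp add: p'_def vp)
  moreover have "q = p'" if "h * r = 1" for r
  proof -
    have "e * (h * r) = h * r" using e(3) by (simp add: mult.assoc[symmetric])
    then have "e = 1" using that by simp
    then show ?thesis by (simp add: q_def)
  qed
  ultimately show thesis using that q p'proj by (auto simp: is_projection_def)
qed

text \<open>Let \<open>v\<close> implement \<open>p \<sim> p'\<close> and let \<open>b\<close> be the inverse of \<open>a\<close> up to \<open>(p, q)\<close>. Then
  \<open>(b + v)g = 1 + n\<close> with \<open>n\<close> nilpotent, for \<open>g = a(1 - p) + v\<^sup>*\<close>.\<close>

lemma invertible_up_to_decomposition:
  fixes a p q p' :: "'a::unital_cstar_algebra"
  assumes F: "is_selfadjoint_ideal F" "p \<in> F"
    and p: "is_projection p" and q: "is_projection q" and p': "is_projection p'" "proj_le p' q"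
    and equiv: "proj_equiv p p'" and inv: "invertible_up_to a p q"
  obtains g l where "l * g = 1" "a - g \<in> F" "q = p' \<Longrightarrow> g * l = 1"
proof -
  obtain v where v: "v * star v = p" "star v * v = p'"
    using equiv by (auto simp: proj_equiv_def)
  obtain b where b: "b = (1 - p) * b * (1 - q)" "(1 - q) * a * (1 - p) * b = 1 - q"
    "b * ((1 - q) * a * (1 - p)) = 1 - p"
    using inv by (auto simp: invertible_up_to_def Let_def)
  have pv: "p * v = v" "star v * p = star v" by (rule partial_isometry[OF p v(1)])+
  have p'v: "p' * star v = star v" "v * p' = v"
    using partial_isometry[of p' "star v"] p'(1) v(2) by (simp_all add: star_star)
  have pp: "p * p = p" "q * q = q" using p q by (simp_all add: is_projection_def)
  have p'q: "p' * q = p'" using p'(2) by (simp add: proj_le_def)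
  then have qp': "q * p' = p'" using p'(1) q by (metis is_projection_def star_mult)
  have qv: "q * star v = star v" by (metis qp' p'v(1) mult.assoc)
  have bq: "b * (1 - q) = b"
    by (subst (2) b(1), subst b(1)) (simp add: mult.assoc right_diff_distrib left_diff_distrib pp)
  have pb: "(1 - p) * b = b"
    by (subst (2) b(1), subst b(1))
      (simp add: mult.assoc right_diff_distrib left_diff_distrib pp pp(1)[THEN mult_eq_reassoc])
  have bv: "b * star v = 0"
  proof -
    have "b * star v = b * ((1 - q) * star v)" by (simp add: mult.assoc[symmetric] bq)
    also have "(1 - q) * star v = 0" by (simp add: left_diff_distrib qv)
    finally show ?thesis by simp
  qed
  have ba: "b * (a * (1 - p)) = 1 - p"
    using b(3) by (simp add: mult.assoc[symmetric] bq)
  define g where "g = a * (1 - p) + star v"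
  define n where "n = v * (a * (1 - p))"
  have nn: "n * n = 0"
  proof -
    have "(1 - p) * v = 0" by (simp add: left_diff_distrib pv)
    then have "(1 - p) * (v * x) = 0" for x using mult_eq_reassoc by fastforce
    then show ?thesis by (simp add: n_def mult.assoc)
  qed
  have bvg: "(b + v) * g = 1 + n"
    by (simp add: g_def distrib_left distrib_right ba bv v n_def)
  define l where "l = (1 - n) * (b + v)"
  have "l * g = (1 - n) * (1 + n)" by (simp add: l_def mult.assoc bvg)
  then have lg: "l * g = 1" by (simp add: distrib_left left_diff_distrib nn)
  have pF: "x * p \<in> F" for x using F by (auto simp: is_selfadjoint_ideal_def)
  have "a - g = (a - star v) * p" by (simp add: g_def algebra_simps pv)
  then have agF: "a - g \<in> F" using pF by simp
  have "g * l = 1" if "q = p'"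
  proof -
    \<comment> \<open>For \<open>q = p'\<close>, \<open>c\<close> is a left inverse of
      \<open>b + v\<close>; then \<open>g = c * (1 + n)\<close>, and \<open>1 - n\<close> cancels
      \<open>1 + n\<close> in \<open>g * l\<close>.\<close>
    define c where "c = (1 - q) * a * (1 - p) + star v"
    have "(1 - p) * v = 0" by (simp add: left_diff_distrib pv)
    moreover have "star v * b = 0"
    proof -
      have "star v * ((1 - p) * b) = 0"
        by (simp add: mult.assoc[symmetric] right_diff_distrib pv)
      then show ?thesis by (simp add: pb)
    qed
    ultimately have cb: "c * (b + v) = 1"
      using b(2) v(2) that by (simp add: c_def distrib_left distrib_right mult.assoc)
    have "g = c * ((b + v) * g)" by (simp add: mult.assoc[symmetric] cb)
    then have "g * l = c * ((1 + n) * (1 - n)) * (b + v)" unfolding bvg by (simp add: l_def mult.assoc)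
    also have "(1 + n) * (1 - n) = 1" by (simp add: right_diff_distrib distrib_right nn)
    finally show ?thesis by (simp add: cb)
  qed
  with lg agF show thesis by (rule that)
qed

text \<open>Multiplying the perturbation \<open>f \<in> F\<close> by \<open>1 - p\<close>, for \<open>p\<close> far out in the approximate unit,
  makes it so small that \<open>g + f(1 - p)\<close> is still left invertible.\<close>

lemma perturbation_invertible_up_to:
  fixes F :: "'a::unital_cstar_algebra set"
  assumes F: "finite_type_ideal F" and lg: "l * g = 1" and f: "a - g \<in> F"
  obtains p p' q where "p \<in> F" "p' \<in> F" "is_projection p" "is_projection p'" "is_projection q"
    "proj_le p' q" "proj_equiv p p'" "invertible_up_to a p q" "g * l = 1 \<Longrightarrow> q = p'"
proof -
  define f where "f = a - g"
  obtain G :: "'a filter" and u where u: "approximate_unit F G u" "\<And>i. is_projection (u i)"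
    and ideal: "is_selfadjoint_ideal F"
    using F by (auto simp: finite_type_ideal_def)
  have "((\<lambda>i. f * u i) \<longlongrightarrow> f) G" "G \<noteq> bot" and uF: "\<And>i. u i \<in> F"
    using u(1) assms(3) by (auto simp: approximate_unit_def f_def)
  \<comment> \<open>Adding 1 to \<open>norm l\<close> keeps the threshold positive even for
    \<open>l = 0\<close>, which occurs in the zero algebra.\<close>
  then have "eventually (\<lambda>i. dist (f * u i) f < 1 / (norm l + 1)) G"
    by (auto simp: tendsto_iff add_nonneg_pos)
  then obtain i where i: "dist (f * u i) f < 1 / (norm l + 1)"
    using \<open>G \<noteq> bot\<close> eventually_happens' by blast
  define p where "p = u i"
  have p: "is_projection p" "p \<in> F" using u(2) uF by (simp_all add: p_def)
  define d where "d = f * (1 - p)"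
  have "norm d < 1 / (norm l + 1)"
    using i by (simp add: d_def p_def right_diff_distrib dist_norm norm_minus_commute)
  then have "norm d * (norm l + 1) < 1" by (simp add: pos_less_divide_eq add_nonneg_pos)
  then have dl: "norm l * norm d < 1"
    using norm_ge_zero[of d] by (simp only: distrib_left mult.commute[of "norm l"])
  have "norm (- (l * d)) < 1" "norm (- (d * l)) < 1"
    using norm_mult_ineq[of l d] norm_mult_ineq[of d l] dl by (simp_all add: mult.commute)
  \<comment> \<open>\<open>x * l\<close> will be a left inverse of \<open>g + d\<close>; if
    \<open>g * l = 1\<close>, then \<open>l * z\<close> is a right inverse.\<close>
  then obtain x z where x: "x * (1 + l * d) = 1" and z: "(1 + d * l) * z = 1"
    using one_minus_invertible by (metis diff_minus_eq_add)
  define h where "h = g + d"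
  have "(x * l) * h = x * (l * g + l * d)" by (simp add: h_def mult.assoc distrib_left)
  then have xlh: "(x * l) * h = 1" using lg x by simp
  have "(1 - p) * (1 - p) = 1 - p"
    using is_projection_one_minus[OF p(1)] by (simp add: is_projection_def)
  then have "h * (1 - p) = g * (1 - p) + f * (1 - p)"
    by (simp add: h_def d_def distrib_right mult.assoc)
  then have "a * (1 - p) = h * (1 - p)" by (simp add: f_def algebra_simps)
  from left_invertible_invertible_up_to[OF xlh p(1) this]
  obtain p' q where P: "is_projection p'" "is_projection q" "proj_le p' q" "proj_equiv p p'"
    "p' \<in> range (\<lambda>x. x * p * star x)" "invertible_up_to a p q"
    "\<And>r. h * r = 1 \<Longrightarrow> q = p'" by metis
  have "p' \<in> F" using P(5) ideal p(2) by (auto simp: is_selfadjoint_ideal_def)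
  moreover have "q = p'" if "g * l = 1"
  proof (rule P(7))
    have "h * (l * z) = (g * l + d * l) * z" by (simp add: h_def mult.assoc distrib_right)
    then show "h * (l * z) = 1" using that z by simp
  qed
  ultimately show thesis using that p P by blast
qed

section \<open>Invertibility modulo \<open>F\<close> and products\<close>

lemma ideal_product_diff:
  fixes a b g1 g2 :: "'a::unital_cstar_algebra"
  assumes "is_subalgebra F" "is_selfadjoint_ideal F" "a - g1 \<in> F" "b - g2 \<in> F"
  shows "a * b - g1 * g2 \<in> F"
proof -
  have "a * b - g1 * g2 = (a - g1) * b + g1 * (b - g2)" by (simp add: algebra_simps)
  then show ?thesis using assms by (simp add: is_subalgebra_def is_selfadjoint_ideal_def)
qed

lemma mult_left_inverse:
  fixes g1 g2 l1 l2 :: "'a::unital_cstar_algebra"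
  assumes "l1 * g1 = 1" "l2 * g2 = 1"
  shows "(l2 * l1) * (g1 * g2) = 1"
  using assms by (simp add: mult.assoc assms(1)[THEN mult_eq_reassoc])

text \<open>This trades the pair of projections for a condition that products visibly
  preserve.\<close>

lemma upper_semi_Weyl_iff:
  fixes F :: "'a::unital_cstar_algebra set"
  assumes F: "finite_type_ideal F"
  shows "a \<in> upper_semi_Weyl F \<longleftrightarrow> (\<exists>g l. l * g = 1 \<and> a - g \<in> F)"
proof
  assume "a \<in> upper_semi_Weyl F"
  then obtain p q p' where P: "is_projection p" "is_projection q" "p \<in> F" "invertible_up_to a p q"
    "is_projection p'" "proj_le p' q" "proj_equiv p p'"
    unfolding upper_semi_Weyl_def proj_subequiv_def by blast
  have "is_selfadjoint_ideal F" using F by (auto simp: finite_type_ideal_def)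
  then show "\<exists>g l. l * g = 1 \<and> a - g \<in> F"
    using invertible_up_to_decomposition[OF _ P(3,1,2,5,6,7,4)] by metis
next
  assume "\<exists>g l. l * g = 1 \<and> a - g \<in> F"
  then show "a \<in> upper_semi_Weyl F"
    using perturbation_invertible_up_to[OF F] unfolding upper_semi_Weyl_def proj_subequiv_def
    by (smt (verit) mem_Collect_eq)
qed

lemma Weyl_type_iff:
  fixes F :: "'a::unital_cstar_algebra set"
  assumes F: "finite_type_ideal F"
  shows "a \<in> Weyl_type F \<longleftrightarrow> (\<exists>g l. l * g = 1 \<and> g * l = 1 \<and> a - g \<in> F)"
proof
  assume "a \<in> Weyl_type F"
  then obtain p q where P: "is_projection p" "is_projection q" "p \<in> F" "q \<in> F"
    "proj_equiv p q" "invertible_up_to a p q"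
    unfolding Weyl_type_def by blast
  have "is_selfadjoint_ideal F" using F by (auto simp: finite_type_ideal_def)
  \<comment> \<open>The decomposition is applied with \<open>q\<close> in the role of
    \<open>p'\<close>, which makes its two-sided conclusion available.\<close>
  moreover have "proj_le q q" using P(2) by (simp add: proj_le_def is_projection_def)
  ultimately show "\<exists>g l. l * g = 1 \<and> g * l = 1 \<and> a - g \<in> F"
    using invertible_up_to_decomposition[OF _ P(3,1,2,2) _ P(5,6)] by metis
next
  assume "\<exists>g l. l * g = 1 \<and> g * l = 1 \<and> a - g \<in> F"
  then show "a \<in> Weyl_type F"
    using perturbation_invertible_up_to[OF F] unfolding Weyl_type_def
    by (smt (verit) mem_Collect_eq)
qed

text \<open>Taking adjoints of all three equations exchanges \<open>p\<close> and \<open>q\<close>,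
  with \<open>star b\<close> as the inverse.\<close>

lemma invertible_up_to_star:
  fixes a p q :: "'a::unital_cstar_algebra"
  assumes "is_projection p" "is_projection q" "invertible_up_to a p q"
  shows "invertible_up_to (star a) q p"
proof -
  have s: "star p = p" "star q = q" using assms by (simp_all add: is_projection_def)
  obtain b where b: "b = (1 - p) * b * (1 - q)" "(1 - q) * a * (1 - p) * b = 1 - q"
    "b * ((1 - q) * a * (1 - p)) = 1 - p"
    using assms(3) by (auto simp: invertible_up_to_def Let_def)
  show ?thesis unfolding invertible_up_to_def Let_def
    using arg_cong[OF b(1), of star] arg_cong[OF b(2), of star] arg_cong[OF b(3), of star]
    by (intro exI[of _ "star b"]) (simp add: star_mult star_diff s mult.assoc)
qed

lemma lower_semi_Weyl_iff_star:
  fixes a :: "'a::unital_cstar_algebra"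
  shows "a \<in> lower_semi_Weyl F \<longleftrightarrow> star a \<in> upper_semi_Weyl F"
  unfolding lower_semi_Weyl_def upper_semi_Weyl_def mem_Collect_eq
  by (metis invertible_up_to_star star_star)

theorem corollary3p21:
  fixes F :: "'a::unital_cstar_algebra set"
  assumes "finite_type_ideal F"
  shows "(\<forall>a\<in>upper_semi_Weyl F. \<forall>b\<in>upper_semi_Weyl F. a * b \<in> upper_semi_Weyl F) \<and>
    (\<forall>a\<in>lower_semi_Weyl F. \<forall>b\<in>lower_semi_Weyl F. a * b \<in> lower_semi_Weyl F) \<and>
    (\<forall>a\<in>Weyl_type F. \<forall>b\<in>Weyl_type F. a * b \<in> Weyl_type F)"
proof -
  have F: "is_subalgebra F" "is_selfadjoint_ideal F"
    using assms by (auto simp: finite_type_ideal_def)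
  have upper: "a * b \<in> upper_semi_Weyl F"
    if "a \<in> upper_semi_Weyl F" "b \<in> upper_semi_Weyl F" for a b
    using that unfolding upper_semi_Weyl_iff[OF assms]
    by (meson ideal_product_diff[OF F] mult_left_inverse)
  moreover have "a * b \<in> lower_semi_Weyl F"
    if "a \<in> lower_semi_Weyl F" "b \<in> lower_semi_Weyl F" for a b
    using upper that by (simp add: lower_semi_Weyl_iff_star star_mult)
  moreover have "a * b \<in> Weyl_type F" if "a \<in> Weyl_type F" "b \<in> Weyl_type F" for a b
    using that unfolding Weyl_type_iff[OF assms]
    by (meson ideal_product_diff[OF F] mult_left_inverse)
  ultimately show ?thesis by blast
qed

end
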